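(* Let $X_1,\dots,X_n$ be an i.i.d. sample from a probability distribution $P$ on $\mathbb{R}^d$, with bounded density, that has a gap of size $\epsilon$ at level $\lambda^*$, with $S_{\lambda^*}=\bigcup_{i=1}^I\mathcal{C}_i$ where $\mathcal{C}_1,\dots,\mathcal{C}_I$ are the disjoint, connected, closed clusters, and let $\sigma=\min_{i\ne j}\mathrm{dist}(\mathcal{C}_i,\mathcal{C}_j)>0$. Set $a_n=C_1\sqrt{\frac{\log n+\log(1/h)}{nh^d}}$ and suppose that the input parameters $h$ and $k$ of the DBSCAN algorithm are such that $$\sigma/4\ \ge\ h\ \ge\ C\left(\frac{\log n}{n\epsilon^2}\right)^{1/d}\quad\text{and}\quad k=\lceil nh^dV_d\lambda\rceil,$$ for any $C>0$ such that $2a_n<\epsilon$ and any $\lambda\in(\lambda^*-\epsilon+a_n,\ \lambda^*-a_n]$. Then, for all $n$ large enough, with probability at least $1-1/n$: (i) simultaneously over all connected sets $A$ such that $A_{2h}\subset\mathcal{C}_i$ for some $i$, all the sample points in $A$, if any, belong to the same connected component of $\mathbb{G}_{h,k}$; (ii) simultaneously over all connected sets $A$ and $A'$ such that $A_{2h}\subset\mathcal{C}_i$ and $A'_{2h}\subset\mathcal{C}_j$ for some $i\ne j$, the sample points in $A$ and $A'$, if any, belong to distinct connected components of $\mathbb{G}_{h,k}$.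
   Context: $B(x,r)$ is the closed Euclidean ball, $\mathcal{L}$ Lebesgue measure, $V_d=\mathcal{L}(B(0,1))$, and $A_{r}=\bigcup_{x\in A}B(x,r)$ for $r>0$. Gap: let $P$ be absolutely continuous with respect to $\mathcal{L}$. For $\lambda>0$ let $S_\lambda$ be the support of the sub-probability measure $A\mapsto P(A\cap\{p'\ge\lambda\})$, where $p'$ is any density of $P$. $P$ has a gap at $\lambda^*$ of size $\epsilon$, $0<\epsilon<\lambda^*$, if $P(S_{\lambda^*})>0$, $\mathcal{L}(\partial S_{\lambda^*})=0$, and $S_{\lambda^*-\eta}\setminus S_{\lambda^*}=\emptyset$ for all $\eta\in(0,\epsilon)$. Convention: for such $P$, $p$ denotes a density of $P$ with $p\ge\lambda^*$ on $S_{\lambda^*}$ and $p\le\lambda^*-\epsilon$ on $S_{\lambda^*}^c$, so that $S_{\lambda^*}=\mathrm{cl}\{p\ge\lambda^*\}$ and $\mathrm{cl}(S_{\lambda^*}^c)=\mathrm{cl}\{p\le\lambda^*-\epsilon\}$. DBSCAN graph: $\mathbb{G}_{h,k}$ has nodes $\{X_i:|B(X_i,h)\cap\{X_j\}_{j=1}^n|\ge k\}$ and an edge between nodes $X_i,X_j$ iff $\|X_i-X_j\|<2h$. Let $\widehat p_h(x)=\frac{|B(x,h)\cap\{X_i\}_{i=1}^n|}{nh^dV_d}$ and $p_h(x)=\frac{P(B(x,h))}{h^dV_d}$. The constant $C_1$ (depending on $\|p\|_\infty$ and $d$) is such that for all $n$ large enough with $nh^d\ge1$, $\sup_x|\widehat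 p_h(x)-p_h(x)|\le C_1\sqrt{\frac{\log n+\log(1/h)}{nh^d}}=a_n$ with probability at least $1-1/n$. The quantities $\epsilon$ and $\sigma$ (hence $P$) may vary with $n$. *)

theory Defs
  imports "Graph_Theory.Digraph_Component" "HOL-Probability.Probability"
begin

text \<open>
  Throughout, the ambient space R^d is a type of class \<open>euclidean_space\<close>, with d = \<open>DIM('a)\<close>.
\<close>

definition unit_vol :: "'a::euclidean_space itself \<Rightarrow> real" where
  "unit_vol _ = measure lborel (cball (0::'a) 1)"

definition thicken :: "real \<Rightarrow> 'a::euclidean_space set \<Rightarrow> 'a set" where
  "thicken r A = (\<Union>x\<in>A. cball x r)"


subsection \<open>Support of level sets and gaps\<close>

definition measure_support :: "'a::topological_space measure \<Rightarrow> 'a set" where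
  "measure_support M = {x. \<forall>U. open U \<and> x \<in> U \<longrightarrow> 0 < emeasure M U}"

text \<open>
  The measure \<open>A \<mapsto> P (A \<inter> {p' \<ge> lam})\<close> is written with the Radon-Nikodym
  derivative of \<open>P\<close> as the density \<open>p'\<close>; by the lemma
  \<open>level_support_density\<close> below any other density gives the same support.
\<close>

definition level_support :: "'a::euclidean_space measure \<Rightarrow> real \<Rightarrow> 'a set" where
  "level_support P lam =
     measure_support (density P (indicator {x. ennreal lam \<le> RN_deriv lborel P x}))"

lemma level_support_density:
  fixes f :: "'a::euclidean_space \<Rightarrow> ennreal"
  assumes f [measurable]: "f \<in> borel_measurable lborel" and P: "P = density lborel f"
  shows "level_support P lam = measure_support (density P (indicator {x. ennreal lam \<le> f x}))"
proof -
  have ae: "AE x in lborel. f x = RN_deriv lborel P x"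
    by (rule sigma_finite_measure.RN_deriv_unique[OF sigma_finite_lborel f]) (simp add: P)
  have [measurable]: "RN_deriv lborel P \<in> borel_measurable borel"
    using borel_measurable_RN_deriv[of lborel P] by simp
  have [measurable]: "f \<in> borel_measurable borel"
    using f by simp
  have "AE x in P. (indicator {x. ennreal lam \<le> RN_deriv lborel P x} x :: ennreal) =
      indicator {x. ennreal lam \<le> f x} x"
    unfolding P using ae by (subst AE_density) (auto simp: P indicator_def elim!: eventually_mono)
  hence "density P (indicator {x. ennreal lam \<le> RN_deriv lborel P x}) =
      density P (indicator {x. ennreal lam \<le> f x})"
    by (intro density_cong) (auto simp: P)
  thus ?thesis
    by (simp add: level_support_def)
qed

lemma closed_measure_support: "closed (measure_support M)"
proof -
  have "- measure_support M = \<Union>{U. open U \<and> emeasure M U = 0}"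
    by (auto simp: measure_support_def)
  moreover have "open (\<Union>{U. open U \<and> emeasure M U = 0})"
    by auto
  ultimately show ?thesis
    by (simp add: closed_def)
qed

definition has_gap :: "'a::euclidean_space measure \<Rightarrow> real \<Rightarrow> real \<Rightarrow> bool" where
  "has_gap P lam eps \<longleftrightarrow>
     absolutely_continuous lborel P \<and> 0 < eps \<and> eps < lam \<and>
     0 < measure P (level_support P lam) \<and>
     emeasure lborel (frontier (level_support P lam)) = 0 \<and>
     (\<forall>eta\<in>{0<..<eps}. level_support P (lam - eta) - level_support P lam = {})"

text \<open>The version of the density that is used for a distribution with a gap.\<close>

definition gap_density :: "'a::euclidean_space measure \<Rightarrow> real \<Rightarrow> real \<Rightarrow> ('a \<Rightarrow> real) \<Rightarrow> bool" where
  "gap_density P lam eps p \<longleftrightarrow>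
     p \<in> borel_measurable borel \<and> (\<forall>x. 0 \<le> p x) \<and> P = density lborel (\<lambda>x. ennreal (p x)) \<and>
     (\<forall>x\<in>level_support P lam. lam \<le> p x) \<and>
     (\<forall>x. x \<notin> level_support P lam \<longrightarrow> p x \<le> lam - eps)"

lemma gap_density_closures:
  assumes "has_gap P lam eps" "gap_density P lam eps p"
  shows "level_support P lam = closure {x. lam \<le> p x}"
    and "closure (- level_support P lam) = closure {x. p x \<le> lam - eps}"
proof -
  have eps: "0 < eps"
    using assms(1) by (simp add: has_gap_def)
  have ge: "lam \<le> p x" if "x \<in> level_support P lam" for x
    using assms(2) that by (simp add: gap_density_def)
  have le: "p x \<le> lam - eps" if "x \<notin> level_support P lam" for x
    using assms(2) that by (simp add: gap_density_def)
  have "level_support P lam = {x. lam \<le> p x}" "- level_support P lam = {x. p x \<le> lam - eps}"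
    using eps by (auto dest!: ge le) (use ge le in fastforce)+
  thus "level_support P lam = closure {x. lam \<le> p x}"
    "closure (- level_support P lam) = closure {x. p x \<le> lam - eps}"
    by (metis closed_measure_support closure_closed level_support_def, simp)
qed


subsection \<open>Clusters\<close>

text \<open>The qualified name avoids the graph-theoretic \<open>connected\<close>.\<close>

definition cluster_decomposition :: "'a::euclidean_space set \<Rightarrow> nat \<Rightarrow> (nat \<Rightarrow> 'a set) \<Rightarrow> bool" where
  "cluster_decomposition S I K \<longleftrightarrow>
     S = (\<Union>i\<in>{1..I}. K i) \<and> disjoint_family_on K {1..I} \<and>
     (\<forall>i\<in>{1..I}. K i \<noteq> {} \<and> closed (K i) \<and> topological_space_class.connected (K i))"

text \<open>
  The minimal distance between two different clusters. As an infimum in the extended reals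
  it is \<open>\<infinity>\<close> if there is only one cluster.
\<close>

definition cluster_separation :: "nat \<Rightarrow> (nat \<Rightarrow> 'a::euclidean_space set) \<Rightarrow> ereal" where
  "cluster_separation I K =
     (INF (i, j)\<in>{(i, j). i \<in> {1..I} \<and> j \<in> {1..I} \<and> i \<noteq> j}. ereal (setdist (K i) (K j)))"


subsection \<open>Samples\<close>

text \<open>
  Inner probability: the uncountable intersections of events to which this is applied need not be
  measurable a priori. On measurable events it is the usual probability.
\<close>

definition with_prob_ge :: "'w measure \<Rightarrow> real \<Rightarrow> ('w \<Rightarrow> bool) \<Rightarrow> bool" where
  "with_prob_ge M q Q \<longleftrightarrow> (\<exists>E\<in>sets M. q \<le> measure M E \<and> (\<forall>w\<in>E. Q w))"

definition iid_sample ::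
  "'w measure \<Rightarrow> 'a::euclidean_space measure \<Rightarrow> nat \<Rightarrow> (nat \<Rightarrow> 'w \<Rightarrow> 'a) \<Rightarrow> bool" where
  "iid_sample M P n X \<longleftrightarrow>
     prob_space M \<and> prob_space.indep_vars M (\<lambda>_. borel) X {1..n} \<and>
     (\<forall>i\<in>{1..n}. distr M borel (X i) = P)"

text \<open>In the following, \<open>s 1, \<dots>, s n\<close> are the (realized) sample points.\<close>

definition emp_dens :: "nat \<Rightarrow> real \<Rightarrow> (nat \<Rightarrow> 'a::euclidean_space) \<Rightarrow> 'a \<Rightarrow> real" where
  "emp_dens n h s x =
     real (card (cball x h \<inter> s ` {1..n})) / (real n * h ^ DIM('a) * unit_vol TYPE('a))"

definition avg_dens :: "'a::euclidean_space measure \<Rightarrow> real \<Rightarrow> 'a \<Rightarrow> real" where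
  "avg_dens P h x = measure P (cball x h) / (h ^ DIM('a) * unit_vol TYPE('a))"

definition dev_rate :: "nat \<Rightarrow> real \<Rightarrow> nat \<Rightarrow> real \<Rightarrow> real" where
  "dev_rate d C1 n h = C1 * sqrt ((ln (real n) + ln (1 / h)) / (real n * h ^ d))"


subsection \<open>The DBSCAN graph\<close>

definition dbscan_nodes ::
  "nat \<Rightarrow> real \<Rightarrow> nat \<Rightarrow> (nat \<Rightarrow> 'a::euclidean_space) \<Rightarrow> 'a set" where
  "dbscan_nodes n h k s = {s i | i. i \<in> {1..n} \<and> k \<le> card (cball (s i) h \<inter> s ` {1..n})}"

text \<open>
  The undirected graph is represented by the digraph that has both arcs for every edge.
  Its strongly connected components are the connected components of the undirected graph.
\<close>

definition dbscan_graph ::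
  "nat \<Rightarrow> real \<Rightarrow> nat \<Rightarrow> (nat \<Rightarrow> 'a::euclidean_space) \<Rightarrow> 'a pair_pre_digraph" where
  "dbscan_graph n h k s =
     \<lparr>pverts = dbscan_nodes n h k s,
      parcs = {(u, v). u \<in> dbscan_nodes n h k s \<and> v \<in> dbscan_nodes n h k s \<and>
                       u \<noteq> v \<and> norm (u - v) < 2 * h}\<rparr>"

definition dbscan_components ::
  "nat \<Rightarrow> real \<Rightarrow> nat \<Rightarrow> (nat \<Rightarrow> 'a::euclidean_space) \<Rightarrow> 'a set set" where
  "dbscan_components n h k s = pre_digraph.sccs_verts (with_proj (dbscan_graph n h k s))"

end

theory Submission
  imports Defs
begin

text \<open>
  The probabilistic input is a single event: the empirical ball masses are uniformly within
  \<open>a\<close> of the true ones. Everything else is a deterministic argument on that event. The choice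
  of \<open>\<lambda>\<close> puts the threshold at least \<open>a\<close> below \<open>\<lambda>\<^sup>*\<close> and more than \<open>a\<close> above
  \<open>\<lambda>\<^sup>* - \<epsilon>\<close>. As the density is at least \<open>\<lambda>\<^sup>*\<close> on the clusters and at most
  \<open>\<lambda>\<^sup>* - \<epsilon>\<close> off them, a ball of radius \<open>h\<close> inside a cluster holds at least \<open>k\<close>
  points, and a ball that holds \<open>k\<close> points meets a cluster (\<open>avg_dens_ge\<close>, \<open>avg_dens_le\<close>).

  Separation follows: every node is within \<open>h\<close> of a cluster, an edge is shorter than \<open>2h\<close>,
  and clusters are at least \<open>4h\<close> apart, so a path cannot pass from the neighbourhood of one
  cluster to that of another (\<open>dbscan_reachable_same_cluster\<close>).

  Connectedness of the part of the graph near \<open>A\<close> is inherited from \<open>A\<close>: the closed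
  \<open>h\<close>-balls around the nodes near \<open>A\<close> cover \<open>A\<close>, and if these nodes fell into several
  components, the balls of one component and those of the others would be two closed sets that
  cover \<open>A\<close> and do not meet in \<open>A\<close> (\<open>connected_finite_closed_cover\<close>). The delicate point is that the graph
  joins points at distance strictly less than \<open>2h\<close>, whereas closed balls already touch at
  distance \<open>2h\<close>. When two balls touch in one point \<open>x\<close> only, their centres are antipodal on
  the sphere of radius \<open>h\<close> around \<open>x\<close>, and any third sample point in the ball around \<open>x\<close>
  is strictly closer than \<open>2h\<close> to both (\<open>third_point_bridges_ball\<close>). There is one, since
  the lower bound on \<open>h\<close> makes \<open>n h\<^sup>d\<close> grow at least like \<open>log n\<close>
  (\<open>expected_ball_count_lower_bound\<close>): balls inside the clusters eventually contain at least
  three points.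
\<close>

section \<open>Connected sets covered by balls\<close>

text \<open>
  A connected set links the members of a finite closed cover: the members related to \<open>F i\<close> and
  the remaining ones have closed unions, and a common point of these unions in \<open>A\<close> would
  relate a remaining member to \<open>F i\<close> by transitivity.
\<close>

lemma connected_finite_closed_cover:
  fixes A :: "'a::topological_space set"
  assumes A: "topological_space_class.connected A"
    and J: "finite J" and closed: "\<And>j. j \<in> J \<Longrightarrow> closed (F j)"
    and cover: "A \<subseteq> (\<Union>j\<in>J. F j)"
    and meet: "\<And>i j x. \<lbrakk>i \<in> J; j \<in> J; x \<in> A; x \<in> F i; x \<in> F j\<rbrakk> \<Longrightarrow> R i j"
    and R: "transp R"
    and i: "i \<in> J" "A \<inter> F i \<noteq> {}" and j: "j \<in> J" "A \<inter> F j \<noteq> {}"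
  shows "R i j"
proof (rule ccontr)
  assume not: "\<not> R i j"
  define U where "U = (\<Union>l\<in>{l\<in>J. R i l}. F l)"
  define V where "V = (\<Union>l\<in>{l\<in>J. \<not> R i l}. F l)"
  have cl: "closed U" "closed V"
    using J closed unfolding U_def V_def by auto
  have "R i i"
    using i meet by blast
  hence U: "A \<inter> U \<noteq> {}"
    using i unfolding U_def by blast
  have V: "A \<inter> V \<noteq> {}"
    using j not unfolding V_def by blast
  have "U \<inter> V \<inter> A = {}"
    using meet R unfolding U_def V_def transp_def by blast
  moreover have "A \<subseteq> U \<union> V"
    using cover unfolding U_def V_def by blast
  ultimately show False
    using A cl U V unfolding connected_closed by blast
qed

text \<open>
  This is the equality case of the triangle inequality; by the parallelogram law the vectors from
  the centre to the two points add up to zero.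
\<close>

lemma diametral_points_antipodal:
  fixes u v x :: "'a::real_inner"
  assumes "dist x u \<le> h" "dist x v \<le> h" "2 * h \<le> dist u v"
  shows "u - x = - (v - x)"
proof -
  define a where "a = u - x"
  define b where "b = v - x"
  have ab: "norm a \<le> h" "norm b \<le> h" "2 * h \<le> norm (a - b)"
    using assms unfolding a_def b_def dist_norm by (simp_all add: norm_minus_commute)
  have h: "0 \<le> h"
    using ab(1) norm_ge_zero order_trans by blast
  have "(norm (a + b))\<^sup>2 + (norm (a - b))\<^sup>2 = 2 * (norm a)\<^sup>2 + 2 * (norm b)\<^sup>2"
    by (simp add: power2_norm_eq_inner inner_add inner_diff inner_commute)
  moreover have "(norm a)\<^sup>2 \<le> h\<^sup>2" "(norm b)\<^sup>2 \<le> h\<^sup>2" "(2 * h)\<^sup>2 \<le> (norm (a - b))\<^sup>2"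
    using ab h power_mono[of "2 * h" "norm (a - b)" 2] by (auto intro: power_mono)
  moreover have "(2 * h)\<^sup>2 = 4 * h\<^sup>2"
    by simp
  ultimately have "(norm (a + b))\<^sup>2 \<le> 0"
    by linarith
  hence "a + b = 0"
    by simp
  thus ?thesis
    unfolding a_def b_def by (simp only: eq_neg_iff_add_eq_0)
qed

text \<open>
  A point of the ball has at most one point of the ball at distance \<open>2 * h\<close>, namely its
  antipode. So a third point is strictly closer than \<open>2 * h\<close> to both ends of a diameter.
\<close>

lemma third_point_bridges_ball:
  fixes x :: "'a::real_inner"
  assumes "3 \<le> card T" and T: "T \<subseteq> cball x h" and uv: "u \<in> T" "v \<in> T"
  shows "dist u v < 2 * h \<or> (\<exists>y\<in>T. y \<noteq> u \<and> y \<noteq> v \<and> dist u y < 2 * h \<and> dist y v < 2 * h)"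
proof (rule disjCI)
  assume "\<not> (\<exists>y\<in>T. y \<noteq> u \<and> y \<noteq> v \<and> dist u y < 2 * h \<and> dist y v < 2 * h)"
  moreover have "\<not> T \<subseteq> {u, v}"
  proof
    assume "T \<subseteq> {u, v}"
    hence "card T \<le> card {u, v}"
      by (intro card_mono) auto
    also have "\<dots> \<le> 2"
      by (simp add: card_insert_if)
    finally show False
      using assms(1) by simp
  qed
  ultimately obtain y where y: "y \<in> T" "y \<noteq> u" "y \<noteq> v"
    and far: "2 * h \<le> dist u y \<or> 2 * h \<le> dist y v"
    by force
  have ball: "dist x u \<le> h" "dist x v \<le> h" "dist x y \<le> h"
    using T uv y by auto
  show "dist u v < 2 * h"
  proof (rule ccontr)
    assume "\<not> dist u v < 2 * h"
    hence "u - x = - (v - x)"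
      using ball by (intro diametral_points_antipodal) auto
    moreover have "u - x = - (y - x) \<or> y - x = - (v - x)"
      using far ball diametral_points_antipodal by blast
    ultimately have "y = v \<or> y = u"
      by (metis add.inverse_inverse diff_add_cancel)
    thus False
      using y by simp
  qed
qed

section \<open>Reachability in the DBSCAN graph\<close>

lemma pair_sym_digraph_dbscan: "pair_sym_digraph (dbscan_graph n h k s)"
  by unfold_locales (auto simp: dbscan_graph_def symmetric_def intro!: symI simp: norm_minus_commute)

lemma thickenI: "x \<in> A \<Longrightarrow> dist x y \<le> r \<Longrightarrow> y \<in> thicken r A"
  by (auto simp: thicken_def)

lemma subset_thicken: "0 \<le> r \<Longrightarrow> A \<subseteq> thicken r A"
  using thickenI by fastforce

lemma cball_subset_thicken:
  assumes "x \<in> thicken r A"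
  shows "cball x t \<subseteq> thicken (r + t) A"
proof
  fix z assume z: "z \<in> cball x t"
  obtain y where y: "y \<in> A" "dist y x \<le> r"
    using assms by (auto simp: thicken_def)
  have "dist y z \<le> r + t"
    using dist_triangle[of y z x] y z by simp
  thus "z \<in> thicken (r + t) A"
    using y thickenI by blast
qed

text \<open>
  Two conditions on the balls with centre near \<open>A\<close> enter: \<open>k\<close> points make the sample points
  near \<open>A\<close> nodes of the graph, and three points provide the detour between antipodal points,
  which are not joined by an edge.
\<close>

lemma dbscan_reachable_in_dense_set:
  fixes s :: "nat \<Rightarrow> 'a::euclidean_space"
  assumes A: "topological_space_class.connected A" and h: "0 < h"
    and dense: "\<And>x. x \<in> thicken h A \<Longrightarrow>
      k \<le> card (cball x h \<inter> s ` {1..n}) \<and> 3 \<le> card (cball x h \<inter> s ` {1..n})"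
    and u: "u \<in> A \<inter> s ` {1..n}" and v: "v \<in> A \<inter> s ` {1..n}"
  shows "reachable (with_proj (dbscan_graph n h k s)) u v"
proof -
  interpret G: pair_sym_digraph "dbscan_graph n h k s"
    by (rule pair_sym_digraph_dbscan)
  define J where "J = thicken h A \<inter> s ` {1..n}"
  let ?R = "reachable (with_proj (dbscan_graph n h k s))"
  have A_sub: "A \<subseteq> thicken h A"
    using h by (intro subset_thicken) simp
  have node: "y \<in> dbscan_nodes n h k s" if "y \<in> J" for y
    using dense that unfolding J_def dbscan_nodes_def by auto
  have edge: "?R y z" if "y \<in> J" "z \<in> J" "dist y z < 2 * h" for y z
  proof (cases "y = z")
    case True
    thus ?thesis
      using node[OF that(1)] G.reachable_refl[of y] by (simp add: dbscan_graph_def)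
  next
    case False
    thus ?thesis
      using node that by (intro G.reachable_adjI) (auto simp: dbscan_graph_def dist_norm)
  qed
  show ?thesis
  proof (rule connected_finite_closed_cover[OF A, where J = J and F = "\<lambda>y. cball y h" and R = ?R])
    show "finite J"
      by (simp add: J_def)
    show "A \<subseteq> (\<Union>j\<in>J. cball j h)"
    proof
      fix x assume x: "x \<in> A"
      have "cball x h \<inter> s ` {1..n} \<noteq> {}"
        using dense[of x] x A_sub by (metis card.empty not_numeral_le_zero subsetD)
      thus "x \<in> (\<Union>j\<in>J. cball j h)"
        using x thickenI[OF x, of _ h] by (auto simp: J_def dist_commute)
    qed
    show "?R y z" if yz: "y \<in> J" "z \<in> J" "x \<in> A" "x \<in> cball y h" "x \<in> cball z h" for y z x
    proof -
      have "cball x h \<inter> s ` {1..n} \<subseteq> J"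
        using yz(3) by (auto simp: J_def intro: thickenI)
      moreover have "3 \<le> card (cball x h \<inter> s ` {1..n})"
        using dense yz(3) A_sub by blast
      moreover have "y \<in> cball x h \<inter> s ` {1..n}" "z \<in> cball x h \<inter> s ` {1..n}"
        using yz by (auto simp: J_def dist_commute)
      ultimately show ?thesis
        using third_point_bridges_ball[of "cball x h \<inter> s ` {1..n}" x h y z] edge yz G.reachable_trans
        by (meson Int_lower1 subsetD)
    qed
    show "transp ?R"
      by (rule transpI) (rule G.reachable_trans)
    show "u \<in> J" "v \<in> J"
      using u v A_sub by (auto simp: J_def)
    show "A \<inter> cball u h \<noteq> {}" "A \<inter> cball v h \<noteq> {}"
      using u v h by (auto intro!: exI[of _ u] exI[of _ v])
  qed auto
qed

text \<open>
  The cluster near a node is an invariant of the walk: if \<open>x\<close> is within \<open>h\<close> of one cluster and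
  its neighbour \<open>y\<close> within \<open>h\<close> of another, these clusters are closer than
  \<open>h + 2 * h + h\<close>.
\<close>

lemma dbscan_reachable_same_cluster:
  fixes s :: "nat \<Rightarrow> 'a::euclidean_space"
  assumes reach: "reachable (with_proj (dbscan_graph n h k s)) u v"
    and near: "\<And>x. x \<in> dbscan_nodes n h k s \<Longrightarrow> \<exists>l\<in>L. cball x h \<inter> K l \<noteq> {}"
    and sep: "\<And>l m. l \<in> L \<Longrightarrow> m \<in> L \<Longrightarrow> l \<noteq> m \<Longrightarrow> 4 * h \<le> setdist (K l) (K m)"
    and i: "i \<in> L" "cball u h \<inter> K i \<noteq> {}"
  shows "cball v h \<inter> K i \<noteq> {}"
proof -
  interpret G: pair_sym_digraph "dbscan_graph n h k s"
    by (rule pair_sym_digraph_dbscan)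
  show ?thesis
    using reach
  proof (induction rule: G.reachable_induct)
    case base
    show ?case by (rule i(2))
  next
    case (step x y)
    hence y: "y \<in> dbscan_nodes n h k s" and xy: "dist x y < 2 * h"
      by (auto simp: dbscan_graph_def dist_norm)
    obtain m where m: "m \<in> L" "cball y h \<inter> K m \<noteq> {}"
      using near[OF y] by blast
    obtain b c where b: "b \<in> K i" "dist x b \<le> h" and c: "c \<in> K m" "dist y c \<le> h"
      using step.IH m by auto
    have "setdist (K i) (K m) \<le> dist b c"
      using b c by (intro setdist_le_dist)
    also have "\<dots> \<le> dist x b + dist x y + dist y c"
      using dist_triangle[of b c x] dist_triangle[of x c y] by (simp add: dist_commute)
    also have "\<dots> < 4 * h"
      using b c xy by simp
    finally have "m = i"
      using sep i m by force
    thus ?case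
      using m by simp
  qed
qed

text \<open>
  This is the deterministic part of the theorem. It uses the sample only through \<open>dense\<close> and
  \<open>near\<close>, which compare the number of points in a ball with the position of the ball relative
  to the clusters.
\<close>

lemma dbscan_recovers_separated_clusters:
  fixes s :: "nat \<Rightarrow> 'a::euclidean_space"
  assumes h: "0 < h"
    and dense: "\<And>x i. i \<in> L \<Longrightarrow> cball x h \<subseteq> K i \<Longrightarrow>
      k \<le> card (cball x h \<inter> s ` {1..n}) \<and> 3 \<le> card (cball x h \<inter> s ` {1..n})"
    and near: "\<And>x. k \<le> card (cball x h \<inter> s ` {1..n}) \<Longrightarrow> \<exists>l\<in>L. cball x h \<inter> K l \<noteq> {}"
    and sep: "\<And>l m. l \<in> L \<Longrightarrow> m \<in> L \<Longrightarrow> l \<noteq> m \<Longrightarrow> 4 * h \<le> setdist (K l) (K m)"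
  shows "let pts = s ` {1..n}; comps = dbscan_components n h k s in
      (\<forall>A. topological_space_class.connected A \<and> (\<exists>i\<in>L. thicken (2 * h) A \<subseteq> K i) \<longrightarrow>
           A \<inter> pts \<noteq> {} \<longrightarrow> (\<exists>c\<in>comps. A \<inter> pts \<subseteq> c)) \<and>
      (\<forall>A A'. topological_space_class.connected A \<and> topological_space_class.connected A' \<and>
           (\<exists>i\<in>L. \<exists>j\<in>L. i \<noteq> j \<and> thicken (2 * h) A \<subseteq> K i \<and> thicken (2 * h) A' \<subseteq> K j) \<longrightarrow>
           (\<forall>x\<in>A \<inter> pts. \<forall>y\<in>A' \<inter> pts. \<exists>c\<in>comps. \<exists>c'\<in>comps. x \<in> c \<and> y \<in> c' \<and> c \<noteq> c'))"
    (is "let pts = _; comps = _ in ?P pts comps \<and> ?Q pts comps")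
proof -
  interpret G: pair_sym_digraph "dbscan_graph n h k s"
    by (rule pair_sym_digraph_dbscan)
  let ?pts = "s ` {1..n}" and ?comps = "dbscan_components n h k s"
  have inner: "cball x h \<subseteq> K i" if "x \<in> thicken h A" "thicken (2 * h) A \<subseteq> K i" for A x i
    using cball_subset_thicken[OF that(1), of h] that(2) by simp
  have self: "x \<in> thicken h A" if "x \<in> A" for A :: "'a set" and x
    using subset_thicken[of h A] that h by auto
  have comp: "G.scc_of x \<in> ?comps \<and> x \<in> G.scc_of x"
    if "x \<in> A \<inter> ?pts" "i \<in> L" "thicken (2 * h) A \<subseteq> K i" for A x i
  proof -
    have "x \<in> thicken h A"
      using self that by blast
    hence "k \<le> card (cball x h \<inter> ?pts)"
      using dense[OF that(2) inner] that(3) by blast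
    hence "x \<in> dbscan_nodes n h k s"
      using that(1) by (auto simp: dbscan_nodes_def)
    hence "x \<in> pverts (dbscan_graph n h k s)"
      by (simp add: dbscan_graph_def)
    thus ?thesis
      unfolding dbscan_components_def by (simp add: G.scc_of_in_sccs_verts G.in_scc_of_self)
  qed
  have near_node: "\<exists>l\<in>L. cball z h \<inter> K l \<noteq> {}" if "z \<in> dbscan_nodes n h k s" for z
    using near that by (auto simp: dbscan_nodes_def)
  have "?P ?pts ?comps"
  proof (intro allI impI)
    fix A assume A: "topological_space_class.connected A \<and> (\<exists>i\<in>L. thicken (2 * h) A \<subseteq> K i)"
      and "A \<inter> ?pts \<noteq> {}"
    then obtain i u where i: "i \<in> L" "thicken (2 * h) A \<subseteq> K i" and u: "u \<in> A \<inter> ?pts"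
      by blast
    have "A \<inter> ?pts \<subseteq> G.scc_of u"
    proof
      fix v assume v: "v \<in> A \<inter> ?pts"
      have "reachable (with_proj (dbscan_graph n h k s)) u v"
        using A h dense[OF i(1) inner[OF _ i(2)]] u v by (intro dbscan_reachable_in_dense_set) auto
      thus "v \<in> G.scc_of u"
        by (rule G.scc_ofI_reachable')
    qed
    thus "\<exists>c\<in>?comps. A \<inter> ?pts \<subseteq> c"
      using comp[OF u i] by blast
  qed
  moreover have "?Q ?pts ?comps"
  proof (intro allI impI ballI)
    fix A A' x y
    assume "topological_space_class.connected A \<and> topological_space_class.connected A' \<and>
      (\<exists>i\<in>L. \<exists>j\<in>L. i \<noteq> j \<and> thicken (2 * h) A \<subseteq> K i \<and> thicken (2 * h) A' \<subseteq> K j)"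
      and x: "x \<in> A \<inter> ?pts" and y: "y \<in> A' \<inter> ?pts"
    then obtain i j where i: "i \<in> L" "thicken (2 * h) A \<subseteq> K i"
      and j: "j \<in> L" "thicken (2 * h) A' \<subseteq> K j" and ij: "i \<noteq> j"
      by blast
    have xi: "x \<in> K i" and yj: "y \<in> K j"
      using inner[OF self i(2), of x] inner[OF self j(2), of y] x y h by auto
    have "\<not> reachable (with_proj (dbscan_graph n h k s)) x y"
    proof
      assume reach: "reachable (with_proj (dbscan_graph n h k s)) x y"
      have "cball x h \<inter> K i \<noteq> {}"
        using xi h by (meson centre_in_cball disjoint_iff less_imp_le)
      hence "cball y h \<inter> K i \<noteq> {}"
        by (rule dbscan_reachable_same_cluster[OF reach _ _ i(1), rotated 2])
          (use near_node sep in blast)+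
      then obtain b where "b \<in> K i" "dist y b \<le> h"
        by auto
      hence "setdist (K i) (K j) \<le> h"
        using yj setdist_le_dist[of b "K i" y "K j"] by (simp add: dist_commute)
      thus False
        using sep[OF i(1) j(1) ij] h by simp
    qed
    hence "y \<notin> G.scc_of x"
      by (simp add: G.scc_of_def)
    thus "\<exists>c\<in>?comps. \<exists>c'\<in>?comps. x \<in> c \<and> y \<in> c' \<and> c \<noteq> c'"
      using comp[OF x i] comp[OF y j] by metis
  qed
  ultimately show ?thesis
    unfolding Let_def by blast
qed

section \<open>Averaged and empirical densities\<close>

lemma measure_lborel_cball_unit_vol:
  fixes x :: "'a::euclidean_space"
  assumes "0 \<le> h"
  shows "measure lborel (cball x h) = h ^ DIM('a) * unit_vol TYPE('a)"
  using content_cball[OF assms, of x] content_cball[of 1 "0::'a"] unfolding unit_vol_def by simp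

lemma unit_vol_pos: "0 < unit_vol TYPE('a::euclidean_space)"
  unfolding unit_vol_def using content_cball_gt_0_iff[of "0::'a" 1] by simp

lemma avg_dens_ge:
  fixes p :: "'a::euclidean_space \<Rightarrow> real"
  assumes [measurable]: "p \<in> borel_measurable borel" and P: "P = density lborel (\<lambda>x. ennreal (p x))"
    and "finite_measure P" and h: "0 < h" and c: "\<And>y. y \<in> cball x h \<Longrightarrow> c \<le> p y"
  shows "c \<le> avg_dens P h x"
proof -
  interpret finite_measure P by fact
  let ?v = "measure lborel (cball x h)"
  have v: "emeasure lborel (cball x h) = ennreal ?v"
    using emeasure_lborel_cball_finite[of x h] by (simp add: emeasure_eq_ennreal_measure)
  have "ennreal c * ennreal ?v = (\<integral>\<^sup>+y. ennreal c * indicator (cball x h) y \<partial>lborel)"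
    by (subst nn_integral_cmult_indicator) (simp_all add: v)
  also have "\<dots> \<le> (\<integral>\<^sup>+y. ennreal (p y) * indicator (cball x h) y \<partial>lborel)"
    using c by (intro nn_integral_mono) (auto simp: indicator_def intro!: ennreal_leI)
  also have "\<dots> = emeasure P (cball x h)"
    unfolding P by (simp add: emeasure_density)
  also have "\<dots> = ennreal (measure P (cball x h))"
    by (rule emeasure_eq_measure)
  finally have "c * ?v \<le> measure P (cball x h)"
    by (cases "0 \<le> c") (simp_all add: ennreal_mult[symmetric]
      order_trans[OF mult_nonpos_nonneg measure_nonneg])
  thus ?thesis
    using h unit_vol_pos[where 'a='a] unfolding avg_dens_def
    by (simp add: measure_lborel_cball_unit_vol pos_le_divide_eq)
qed

lemma avg_dens_le:
  fixes p :: "'a::euclidean_space \<Rightarrow> real"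
  assumes [measurable]: "p \<in> borel_measurable borel" and P: "P = density lborel (\<lambda>x. ennreal (p x))"
    and h: "0 < h" and c: "0 \<le> c" "\<And>y. y \<in> cball x h \<Longrightarrow> p y \<le> c"
  shows "avg_dens P h x \<le> c"
proof -
  let ?v = "measure lborel (cball x h)"
  have v: "emeasure lborel (cball x h) = ennreal ?v"
    using emeasure_lborel_cball_finite[of x h] by (simp add: emeasure_eq_ennreal_measure)
  have "emeasure P (cball x h) = (\<integral>\<^sup>+y. ennreal (p y) * indicator (cball x h) y \<partial>lborel)"
    unfolding P by (simp add: emeasure_density)
  also have "\<dots> \<le> (\<integral>\<^sup>+y. ennreal c * indicator (cball x h) y \<partial>lborel)"
    using c by (intro nn_integral_mono) (auto simp: indicator_def intro!: ennreal_leI)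
  also have "\<dots> = ennreal (c * ?v)"
    using c by (subst nn_integral_cmult_indicator) (auto simp: v ennreal_mult)
  finally have "measure P (cball x h) \<le> c * ?v"
    using c by (simp add: measure_def enn2real_leI)
  thus ?thesis
    using h unit_vol_pos[where 'a='a] unfolding avg_dens_def
    by (simp add: measure_lborel_cball_unit_vol pos_divide_le_eq)
qed

text \<open>
  A supremum of reals bounds the family only if the family is bounded. Here both
  densities take values in \<open>{0..1 / w}\<close>, where \<open>w\<close> is the volume of a ball of radius \<open>h\<close>.
\<close>

lemma emp_dens_deviation_le_SUP:
  fixes s :: "nat \<Rightarrow> 'a::euclidean_space"
  assumes "prob_space P" and h: "0 < h" and n: "0 < n"
  shows "\<bar>emp_dens n h s x - avg_dens P h x\<bar> \<le> (SUP x. \<bar>emp_dens n h s x - avg_dens P h x\<bar>)"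
proof (rule cSUP_upper)
  interpret prob_space P by fact
  define w where "w = h ^ DIM('a) * unit_vol TYPE('a)"
  have w: "0 < w"
    using h unit_vol_pos[where 'a='a] by (simp add: w_def)
  show "bdd_above (range (\<lambda>x. \<bar>emp_dens n h s x - avg_dens P h x\<bar>))"
  proof (rule bdd_aboveI2)
    fix x
    have "card (cball x h \<inter> s ` {1..n}) \<le> card (s ` {1..n})"
      by (intro card_mono) auto
    also have "\<dots> \<le> n"
      using card_image_le[of "{1..n}" s] by simp
    finally have "emp_dens n h s x \<in> {0..1 / w}"
      using n w unfolding emp_dens_def mult.assoc[of "real n"] w_def[symmetric]
      by (simp add: field_simps)
    moreover have "avg_dens P h x \<in> {0..1 / w}"
      using w unfolding avg_dens_def by (simp add: w_def[symmetric] divide_right_mono)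
    ultimately show "\<bar>emp_dens n h s x - avg_dens P h x\<bar> \<le> 1 / w"
      by auto
  qed
qed simp

section \<open>The expected number of points in a ball\<close>

text \<open>
  Since \<open>eps < lamstar\<close>, the lower bound on \<open>n h\<^sup>d\<close> does not depend on the gap size, which
  may vary with \<open>n\<close>.
\<close>

lemma expected_ball_count_lower_bound:
  fixes h :: real
  assumes C: "0 < C" and d: "0 < d" and n: "2 \<le> n" and eps: "0 < eps" "eps < lamstar"
    and h: "C * (ln (real n) / (real n * eps\<^sup>2)) powr (1 / real d) \<le> h"
  shows "0 < h" and "C ^ d / lamstar\<^sup>2 * ln (real n) \<le> real n * h ^ d"
proof -
  define L where "L = ln (real n) / (real n * eps\<^sup>2)"
  have L: "0 < L"
    using n eps by (simp add: L_def)
  have pos: "0 < C * L powr (1 / real d)"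
    using C L by simp
  thus "0 < h"
    using h unfolding L_def by linarith
  have "(L powr (1 / real d)) ^ d = L"
    using L d by (simp add: powr_realpow[symmetric] powr_powr)
  hence "C ^ d * L = (C * L powr (1 / real d)) ^ d"
    by (simp add: power_mult_distrib)
  also have "\<dots> \<le> h ^ d"
    using h pos unfolding L_def by (intro power_mono) auto
  finally have "real n * (C ^ d * L) \<le> real n * h ^ d"
    by (rule mult_left_mono) simp
  moreover have "real n * (C ^ d * L) = C ^ d * (ln (real n) / eps\<^sup>2)"
    using n by (simp add: L_def)
  moreover have "C ^ d * (ln (real n) / lamstar\<^sup>2) \<le> C ^ d * (ln (real n) / eps\<^sup>2)"
    using C n eps by (intro mult_left_mono divide_left_mono power_mono mult_pos_pos) auto
  ultimately show "C ^ d / lamstar\<^sup>2 * ln (real n) \<le> real n * h ^ d"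
    by simp
qed

section \<open>Consistency of the clusters\<close>

theorem proposition4:
  fixes M :: "nat \<Rightarrow> 'w measure"
    and P :: "nat \<Rightarrow> 'a::euclidean_space measure"
    and p :: "nat \<Rightarrow> 'a \<Rightarrow> real"
    and X :: "nat \<Rightarrow> nat \<Rightarrow> 'w \<Rightarrow> 'a"
    and lamstar C C1 :: real
    and eps h lam a :: "nat \<Rightarrow> real"
    and I k :: "nat \<Rightarrow> nat"
    and K :: "nat \<Rightarrow> nat \<Rightarrow> 'a set"
    and sigma :: "nat \<Rightarrow> ereal"
  assumes a: "\<And>n. a n = dev_rate DIM('a) C1 n (h n)"
    and sample: "\<And>n. iid_sample (M n) (P n) n (X n)"
    and P: "\<And>n. prob_space (P n)"
    and gap: "\<And>n. has_gap (P n) lamstar (eps n)"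
    and p: "\<And>n. gap_density (P n) lamstar (eps n) (p n)"
    and bounded_density: "\<And>n. bounded (range (p n))"
    and clusters: "\<And>n. cluster_decomposition (level_support (P n) lamstar) (I n) (K n)"
    and sigma: "\<And>n. sigma n = cluster_separation (I n) (K n)"
    and sigma_pos: "\<And>n. 0 < sigma n"
    and C1: "\<forall>\<^sub>F n in sequentially. 1 \<le> real n * h n ^ DIM('a) \<longrightarrow>
      with_prob_ge (M n) (1 - 1 / real n)
        (\<lambda>w. (SUP x. \<bar>emp_dens n (h n) (\<lambda>i. X n i w) x - avg_dens (P n) (h n) x\<bar>) \<le> a n)"
    and C: "0 < C"
    and h_upper: "\<forall>\<^sub>F n in sequentially. ereal (h n) \<le> sigma n / 4"
    and h_lower: "\<forall>\<^sub>F n in sequentially.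
      C * (ln (real n) / (real n * (eps n)\<^sup>2)) powr (1 / real DIM('a)) \<le> h n"
    and a_eps: "\<forall>\<^sub>F n in sequentially. 2 * a n < eps n"
    and lam: "\<forall>\<^sub>F n in sequentially. lam n \<in> {lamstar - eps n + a n <.. lamstar - a n}"
    and k: "\<forall>\<^sub>F n in sequentially.
      k n = nat \<lceil>real n * h n ^ DIM('a) * unit_vol TYPE('a) * lam n\<rceil>"
  shows "\<forall>\<^sub>F n in sequentially. with_prob_ge (M n) (1 - 1 / real n) (\<lambda>w.
    let s = (\<lambda>i. X n i w); pts = s ` {1..n}; comps = dbscan_components n (h n) (k n) s in
      (\<forall>A. topological_space_class.connected A \<and>
           (\<exists>i\<in>{1..I n}. thicken (2 * h n) A \<subseteq> K n i) \<longrightarrow>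
           A \<inter> pts \<noteq> {} \<longrightarrow> (\<exists>c\<in>comps. A \<inter> pts \<subseteq> c)) \<and>
      (\<forall>A A'. topological_space_class.connected A \<and> topological_space_class.connected A' \<and>
           (\<exists>i\<in>{1..I n}. \<exists>j\<in>{1..I n}. i \<noteq> j \<and>
              thicken (2 * h n) A \<subseteq> K n i \<and> thicken (2 * h n) A' \<subseteq> K n j) \<longrightarrow>
           (\<forall>x\<in>A \<inter> pts. \<forall>y\<in>A' \<inter> pts. \<exists>c\<in>comps. \<exists>c'\<in>comps. x \<in> c \<and> y \<in> c' \<and> c \<noteq> c')))"
proof -
  define w where "w n = real n * h n ^ DIM('a) * unit_vol TYPE('a)" for n
  note gap' = gap[unfolded has_gap_def]
  note p' = p[unfolded gap_density_def]
  have eps: "0 < eps n" "eps n < lamstar" for n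
    using gap'[of n] by auto
  have lamstar: "0 < lamstar"
    using eps[of 0] by linarith
  \<comment> \<open>The bound \<open>1\<close> enables the deviation inequality. As \<open>a n < lamstar / 2\<close>, the
    other term gives more than three points to a ball inside a cluster.\<close>
  define c where "c = max 1 (6 / (lamstar * unit_vol TYPE('a)))"
  have "filterlim (\<lambda>n. C ^ DIM('a) / lamstar\<^sup>2 * ln (real n)) at_top sequentially"
    using C lamstar by (intro filterlim_tendsto_pos_mult_at_top[OF tendsto_const]
      filterlim_compose[OF ln_at_top filterlim_real_sequentially]) auto
  hence "\<forall>\<^sub>F n in sequentially. c < C ^ DIM('a) / lamstar\<^sup>2 * ln (real n)"
    by (simp add: filterlim_at_top_dense)
  thus ?thesis
    using C1 h_upper h_lower a_eps lam k eventually_ge_at_top[of 2]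
  proof eventually_elim
    case (elim n)
    note bound = expected_ball_count_lower_bound[OF C DIM_positive[where 'a='a] elim(8) eps elim(4)]
    have h: "0 < h n"
      by (rule bound(1))
    have nhd: "c < real n * h n ^ DIM('a)"
      using elim(1) bound(2) by linarith
    have "1 \<le> real n * h n ^ DIM('a)"
      using nhd by (simp add: c_def)
    then obtain E where E: "E \<in> sets (M n)" "1 - 1 / real n \<le> measure (M n) E"
      and dev: "\<And>\<omega>. \<omega> \<in> E \<Longrightarrow>
        (SUP x. \<bar>emp_dens n (h n) (\<lambda>i. X n i \<omega>) x - avg_dens (P n) (h n) x\<bar>) \<le> a n"
      using elim(2) unfolding with_prob_ge_def by blast
    have "6 / (lamstar * unit_vol TYPE('a)) < real n * h n ^ DIM('a)"
      using nhd by (simp add: c_def)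
    hence w6: "6 < lamstar * w n"
      using lamstar unit_vol_pos[where 'a='a] unfolding w_def
      by (simp add: pos_divide_less_eq mult_ac)
    hence w: "0 < w n"
      using lamstar by (smt (verit) mult_nonneg_nonpos)
    have emp: "emp_dens n (h n) s x = real (card (cball x (h n) \<inter> s ` {1..n})) / w n"
      for s and x :: 'a
      by (simp add: emp_dens_def w_def)
    have S: "level_support (P n) lamstar = (\<Union>i\<in>{1..I n}. K n i)"
      using clusters[of n] by (simp add: cluster_decomposition_def)
    have sep: "4 * h n \<le> setdist (K n i) (K n j)"
      if "i \<in> {1..I n}" "j \<in> {1..I n}" "i \<noteq> j" for i j
    proof -
      have "sigma n \<le> ereal (setdist (K n i) (K n j))"
        unfolding sigma cluster_separation_def using that by (intro INF_lower2[of "(i, j)"]) auto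
      with elim(3) have "ereal (h n) \<le> ereal (setdist (K n i) (K n j)) / 4"
        by (cases "sigma n") auto
      thus ?thesis
        by simp
    qed
    show ?case (is "with_prob_ge _ _ ?Q")
      unfolding with_prob_ge_def
    proof (intro bexI[OF _ E(1)] conjI[OF E(2)] ballI)
      fix \<omega> assume \<omega>: "\<omega> \<in> E"
      define s where "s = (\<lambda>i. X n i \<omega>)"
      have close: "\<bar>emp_dens n (h n) s x - avg_dens (P n) (h n) x\<bar> \<le> a n" for x
        using emp_dens_deviation_le_SUP[OF P[of n] h, of n s x] dev[OF \<omega>] elim(8)
        by (simp add: s_def)
      have dense: "k n \<le> card (cball x (h n) \<inter> s ` {1..n}) \<and> 3 \<le> card (cball x (h n) \<inter> s ` {1..n})"
        if "i \<in> {1..I n}" "cball x (h n) \<subseteq> K n i" for x i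
      proof -
        have "lamstar \<le> avg_dens (P n) (h n) x"
          using p'[of n] P[of n] S that h
          by (intro avg_dens_ge[of "p n"]) (auto simp: prob_space.finite_measure)
        hence ge: "(lamstar - a n) * w n \<le> real (card (cball x (h n) \<inter> s ` {1..n}))"
          using close[of x] w by (simp add: emp pos_le_divide_eq[symmetric])
        have "lam n * w n \<le> (lamstar - a n) * w n"
          using elim(6) w by (intro mult_right_mono) auto
        hence "k n \<le> card (cball x (h n) \<inter> s ` {1..n})"
          using ge unfolding elim(7) w_def by (simp add: ceiling_le_iff nat_le_iff mult_ac)
        moreover have "lamstar / 2 * w n \<le> (lamstar - a n) * w n"
          using elim(5) eps[of n] w by (intro mult_right_mono) auto
        hence "3 < real (card (cball x (h n) \<inter> s ` {1..n}))"
          using ge w6 by linarith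
        ultimately show ?thesis
          by linarith
      qed
      have near: "\<exists>i\<in>{1..I n}. cball x (h n) \<inter> K n i \<noteq> {}"
        if "k n \<le> card (cball x (h n) \<inter> s ` {1..n})" for x
      proof (rule ccontr)
        assume "\<not> ?thesis"
        hence "avg_dens (P n) (h n) x \<le> lamstar - eps n"
          using p'[of n] S h eps[of n] by (intro avg_dens_le[of "p n"]) fastforce+
        hence "emp_dens n (h n) s x < lam n"
          using close[of x] elim(6) by auto
        moreover have "lam n * w n \<le> real (card (cball x (h n) \<inter> s ` {1..n}))"
          using that unfolding elim(7) w_def by (simp add: ceiling_le_iff nat_le_iff mult_ac)
        ultimately show False
          using w by (simp add: emp pos_divide_less_eq)
      qed
      show "?Q \<omega>"
        using dbscan_recovers_separated_clusters[OF h dense near sep] by (simp add: s_def Let_def)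
    qed
  qed
qed

end
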